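(* Let $\Delta=\{z\in\mathbb{C}:|z|<1\}$. For any given $\lambda>0$, the basepoint $[0]_Z\in Z(\Delta)$ contains infinitely many pseudo non-decreasable dilatations $\nu$ such that $\|\nu\|_\infty=\lambda$ and the support set of each $\nu$ in $\Delta$ has empty interior. However, $0$ is the unique non-decreasable dilatation in $[0]_Z$.
   Context: $Bel(\Delta)$ is the Banach space of Beltrami differentials $\mu=\mu(z)\,d\bar z/dz$ on $\Delta$ with finite $L^\infty$-norm (i.e. complex-valued $\mu\in L^\infty(\Delta)$; elements are identified when equal a.e.). The norm is not required to be less than $1$. $Q(\Delta)$ is the Banach space of holomorphic functions (quadratic differentials) $\varphi$ on $\Delta$ with $\|\varphi\|=\iint_\Delta|\varphi(z)|\,dxdy<\infty$. Two elements $\mu,\nu\in Bel(\Delta)$ are infinitesimally Teichmüller equivalent if $\iint_\Delta(\mu-\nu)\varphi\,dxdy=0$ for all $\varphi\in Q(\Delta)$; $[\mu]_Z$ denotes the equivalence class of $\mu$, and $Z(\Delta)$ is the quotient space. A Beltrami differential $\mu$ (also called a dilatation) is non-decreasable in $[\mu]_Z$ if, for $\nu\in[\mu]_Z$, $|\nu(z)|\le|\mu(z)|$ a.e. in $\Delta$ implies $\nu=\mu$ (a.e.); otherwise it is decreasable. $\mu$ is strongly decreasable in $[\mu]_Z$ if there exists $\nu\in[\mu]_Z$ such that (A) $|\nu(z)|\le|\mu(z)|$ for almost all $z\in\Delta$, and (B) there exist a (nonempty) domain $G\subset\Delta$ and $\delta>0$ with $|\nu(z)|\le|\mu(z)|-\delta$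 for almost all $z\in G$. Otherwise $\mu$ is weakly non-decreasable. $\mu$ is pseudo non-decreasable if it is weakly non-decreasable but not non-decreasable. The support set of $\nu$ in $\Delta$ is the complement in $\Delta$ of the largest open subset of $\Delta$ on which $\nu=0$ a.e. *)

theory Defs
  imports "HOL-Analysis.Analysis" "HOL-Probability.Essential_Supremum"
begin

abbreviation disk :: "complex set" where
  "disk \<equiv> ball 0 1"

abbreviation disk_measure :: "complex measure" where
  "disk_measure \<equiv> lebesgue_on disk"

definition Linf_norm :: "(complex \<Rightarrow> complex) \<Rightarrow> ereal" where
  "Linf_norm \<mu> = esssup disk_measure (\<lambda>z. ereal (cmod (\<mu> z)))"

text \<open>Elements of \<open>Bel\<close> and \<open>Q\<close> are functions on the whole plane, of which only the
  values on the disk matter. In \<open>Bel\<close> the identification of functions that agree almost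
  everywhere is kept separate, as the relation \<open>ae_eq\<close>.\<close>

definition Bel :: "(complex \<Rightarrow> complex) set" where
  "Bel = {\<mu>. \<mu> \<in> borel_measurable disk_measure \<and> Linf_norm \<mu> < \<infinity>}"

definition ae_eq :: "((complex \<Rightarrow> complex) \<times> (complex \<Rightarrow> complex)) set" where
  "ae_eq = {(\<mu>, \<nu>). \<mu> \<in> Bel \<and> \<nu> \<in> Bel \<and> (AE z in disk_measure. \<mu> z = \<nu> z)}"

lemma equiv_ae_eq: "equiv Bel ae_eq"
proof (rule equivI)
  show "ae_eq \<subseteq> Bel \<times> Bel" by (auto simp: ae_eq_def)
  show "refl_on Bel ae_eq" by (auto simp: refl_on_def ae_eq_def)
  show "sym ae_eq" by (auto simp: sym_def ae_eq_def elim: eventually_mono)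
  show "trans ae_eq"
    unfolding trans_def ae_eq_def by (auto elim: eventually_elim2)
qed

definition Q :: "(complex \<Rightarrow> complex) set" where
  "Q = {\<phi>. \<phi> holomorphic_on disk \<and> integrable disk_measure \<phi>}"

definition Z_class :: "(complex \<Rightarrow> complex) \<Rightarrow> (complex \<Rightarrow> complex) set" where
  "Z_class \<mu> = {\<nu> \<in> Bel. \<forall>\<phi>\<in>Q. (\<integral>z. (\<mu> z - \<nu> z) * \<phi> z \<partial>disk_measure) = 0}"

definition non_decreasable :: "(complex \<Rightarrow> complex) \<Rightarrow> bool" where
  "non_decreasable \<mu> \<longleftrightarrow>
     (\<forall>\<nu>\<in>Z_class \<mu>. (AE z in disk_measure. cmod (\<nu> z) \<le> cmod (\<mu> z)) \<longrightarrow>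
        (AE z in disk_measure. \<nu> z = \<mu> z))"

definition strongly_decreasable :: "(complex \<Rightarrow> complex) \<Rightarrow> bool" where
  "strongly_decreasable \<mu> \<longleftrightarrow>
     (\<exists>\<nu>\<in>Z_class \<mu>. (AE z in disk_measure. cmod (\<nu> z) \<le> cmod (\<mu> z)) \<and>
        (\<exists>G \<delta>. open G \<and> connected G \<and> G \<noteq> {} \<and> G \<subseteq> disk \<and> \<delta> > 0 \<and>
           (AE z in disk_measure. z \<in> G \<longrightarrow> cmod (\<nu> z) \<le> cmod (\<mu> z) - \<delta>)))"

definition weakly_non_decreasable :: "(complex \<Rightarrow> complex) \<Rightarrow> bool" where
  "weakly_non_decreasable \<mu> \<longleftrightarrow> \<not> strongly_decreasable \<mu>"

definition pseudo_non_decreasable :: "(complex \<Rightarrow> complex) \<Rightarrow> bool" where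
  "pseudo_non_decreasable \<mu> \<longleftrightarrow> weakly_non_decreasable \<mu> \<and> \<not> non_decreasable \<mu>"

definition null_open_sets :: "(complex \<Rightarrow> complex) \<Rightarrow> complex set set" where
  "null_open_sets \<nu> =
     {U. open U \<and> U \<subseteq> disk \<and> (AE z in disk_measure. z \<in> U \<longrightarrow> \<nu> z = 0)}"

definition support_set :: "(complex \<Rightarrow> complex) \<Rightarrow> complex set" where
  "support_set \<nu> = disk - \<Union> (null_open_sets \<nu>)"

text \<open>The union is itself a member, hence the largest open set on which \<open>\<nu>\<close> vanishes
  almost everywhere.\<close>

lemma Union_null_open_sets: "\<Union> (null_open_sets \<nu>) \<in> null_open_sets \<nu>"
proof -
  obtain F where F: "F \<subseteq> null_open_sets \<nu>" "countable F" "\<Union> F = \<Union> (null_open_sets \<nu>)"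
    by (rule Lindelof[of "null_open_sets \<nu>"]) (auto simp: null_open_sets_def)
  have "AE z in disk_measure. \<forall>U\<in>F. z \<in> U \<longrightarrow> \<nu> z = 0"
    using F(1,2) by (subst AE_ball_countable) (auto simp: null_open_sets_def)
  then have "AE z in disk_measure. z \<in> \<Union> F \<longrightarrow> \<nu> z = 0"
    by eventually_elim blast
  then show ?thesis
    unfolding F(3) by (auto simp: null_open_sets_def)
qed

end

theory Submission
  imports Defs "HOL-Complex_Analysis.Cauchy_Integral_Formula"
begin

text \<open>If \<open>E\<close> is a compact, rotation invariant subset of the disk and \<open>\<nu>(z) = z / |z|\<close> on \<open>E\<close>
  and \<open>0\<close> elsewhere, then rotating by an angle \<open>\<pi> / (n + 1)\<close> turns the integral of \<open>\<nu>(z) z\<^sup>n\<close>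
  into its negative; so \<open>\<nu>\<close> annihilates all powers, and by Taylor expansion all of \<open>Q\<close>. If
  moreover \<open>E\<close> has positive measure and empty interior, then \<open>\<nu>\<close> is decreasable to \<open>0\<close>, but not
  strongly, because every domain contains an open set on which \<open>\<nu>\<close> already vanishes. Multiples
  of \<open>\<nu>\<close> by constants of modulus \<open>\<lambda>\<close> give the infinitely many dilatations.\<close>

section \<open>Rotation invariance of planar Lebesgue measure\<close>

text \<open>Invariance under orthogonal maps is taken from \<open>real^2\<close>; this
  identification carries it over to the complex plane. Boxes pull back to boxes with the same sides,
  and a measure that gives every box its volume is \<open>lborel\<close>.\<close>

lemma distr_lborel_Complex:
  "distr lborel borel (\<lambda>v::real^2. Complex (v $ 1) (v $ 2)) = lborel" (is "distr _ _ ?h = _")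
proof (rule lborel_eqI[symmetric])
  fix l u :: complex assume le: "\<And>b. b \<in> Basis \<Longrightarrow> l \<bullet> b \<le> u \<bullet> b"
  have h: "?h \<in> borel_measurable lborel"
    by (auto intro!: borel_measurable_continuous_onI continuous_intros simp: Complex_eq)
  have vim: "?h -` box l u = box (vector [Re l, Im l]) (vector [Re u, Im u])"
    by (auto simp: in_box_complex_iff mem_box_cart forall_2)
  have "Re l \<le> Re u" "Im l \<le> Im u"
    using le[of 1] le[of \<i>] by (auto simp: Basis_complex_def)
  then show "emeasure (distr lborel borel ?h) (box l u) = (\<Prod>b\<in>Basis. (u - l) \<bullet> b)"
    using h
    by (subst emeasure_distr)
      (simp_all add: vim emeasure_lborel_box_eq Basis_vec_def UNIV_2 Basis_complex_def axis_eq_axis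
        inner_axis ennreal_mult mult.commute cart_eq_inner_axis[symmetric])
qed simp

text \<open>Conjugated with the identification of the plane with \<open>real^2\<close>,
  multiplication by a unimodular number is linear and preserves norms. It is thus orthogonal there
  and preserves the measure of boxes.\<close>

lemma distr_lborel_rotation:
  fixes a :: complex
  assumes a: "cmod a = 1"
  shows "distr lborel borel ((*) a) = lborel"
proof -
  define h :: "real^2 \<Rightarrow> complex" where "h = (\<lambda>v. Complex (v $ 1) (v $ 2))"
  define k :: "complex \<Rightarrow> real^2" where "k = (\<lambda>z. vector [Re z, Im z])"
  have hk: "h (k z) = z" and kh: "k (h v) = v" for z v
    by (auto simp: h_def k_def vec_eq_iff forall_2)
  have linh: "linear h" and link: "linear k"
    by (auto intro!: linearI simp: h_def k_def complex_eq_iff vec_eq_iff forall_2)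
  have normh: "norm (h v) = norm v" for v
    by (simp add: h_def cmod_def norm_vec_def L2_set_def UNIV_2)
  have normk: "norm (k z) = norm z" for z
    by (metis hk normh)
  have a0: "a \<noteq> 0" using a by auto
  define R where "R b = (\<lambda>v. k (b * h v))" for b
  have linR: "linear (R b)" for b
    unfolding R_def
    using linear_compose[OF linear_compose[OF linh linear_times] link, of b] by (simp add: o_def)
  have orth: "orthogonal_transformation (R (inverse a))"
    unfolding orthogonal_transformation
    using linR a by (auto simp: R_def normk normh norm_mult norm_inverse)
  have mR: "R b \<in> borel_measurable borel" for b
    using linR linear_continuous_on borel_measurable_continuous_onI linear_conv_bounded_linear by blast
  have mh: "h \<in> borel_measurable borel"
    using linh linear_continuous_on borel_measurable_continuous_onI linear_conv_bounded_linear by blast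
  have mt: "(*) a \<in> borel_measurable borel" by measurable
  have "distr lborel borel (R a) = lborel"
  proof (rule lborel_eqI[symmetric])
    fix l u :: "real^2" assume le: "\<And>b. b \<in> Basis \<Longrightarrow> l \<bullet> b \<le> u \<bullet> b"
    \<comment> \<open>A pushforward measures preimages, whereas orthogonal invariance is a statement
      about images; passing to the inverse rotation connects the two.\<close>
    have "R a -` box l u = R (inverse a) ` box l u"
    proof (intro equalityI subsetI)
      fix v assume "v \<in> R a -` box l u"
      moreover have "v = R (inverse a) (R a v)"
        using a0 by (simp add: R_def hk kh mult.assoc[symmetric])
      ultimately show "v \<in> R (inverse a) ` box l u" by blast
    next
      fix v assume "v \<in> R (inverse a) ` box l u"
      then show "v \<in> R a -` box l u"
        using a0 by (auto simp: R_def hk kh mult.assoc[symmetric])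
    qed
    moreover have "R (inverse a) ` box l u \<in> lmeasurable"
      "measure lebesgue (R (inverse a) ` box l u) = measure lebesgue (box l u)"
      by (intro measurable_orthogonal_image measure_orthogonal_image orth lmeasurable_box)+
    ultimately have "emeasure lebesgue (R a -` box l u) = emeasure lebesgue (box l u)"
      by (simp add: emeasure_eq_measure2)
    moreover have "R a -` box l u \<in> sets borel"
      using measurable_sets[OF mR, of "box l u" a] by simp
    ultimately have "emeasure lborel (R a -` box l u) = emeasure lborel (box l u)"
      by simp
    then show "emeasure (distr lborel borel (R a)) (box l u) = (\<Prod>b\<in>Basis. (u - l) \<bullet> b)"
      using le mR by (subst emeasure_distr) auto
  qed simp
  then have "distr lborel borel ((*) a) = distr (distr lborel borel h) borel ((*) a)"
    using distr_lborel_Complex by (simp add: h_def)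
  also have "\<dots> = distr lborel borel (\<lambda>v. h (R a v))"
    using mh mt by (subst distr_distr) (auto simp: o_def R_def hk)
  also have "\<dots> = distr (distr lborel borel (R a)) borel h"
    using mh mR by (subst distr_distr) (auto simp: o_def)
  also have "\<dots> = lborel"
    using distr_lborel_Complex \<open>distr lborel borel (R a) = lborel\<close> by (simp add: h_def)
  finally show ?thesis .
qed

section \<open>A fat rotation invariant set without interior\<close>

text \<open>Removing a small neighbourhood of the null set of points of rational modulus leaves a
  compact set of positive measure; rotating it around the origin keeps the rational moduli out.\<close>
lemma fat_rotation_invariant_set:
  obtains E :: "complex set" where
    "compact E" "E \<subseteq> cball 0 (1/2)" "interior E = {}" "0 \<notin> E"
    "\<forall>z w. cmod z = cmod w \<longrightarrow> (z \<in> E \<longleftrightarrow> w \<in> E)" "emeasure lebesgue E > 0"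
proof -
  define A where "A = {z::complex. cmod z \<in> \<rat>}"
  have A: "A = (\<Union>q\<in>\<rat>. sphere 0 q)"
    by (auto simp: A_def)
  have negA: "negligible A"
    unfolding A by (intro negligible_countable_Union) (auto simp: countable_rat negligible_sphere)
  \<comment> \<open>With the area of the half-radius disk as tolerance, \<open>U\<close> cannot
    cover almost all of that disk: if \<open>K\<close> were null, the disk would lie in
    \<open>U - A\<close> up to a null set, yet \<open>U - A\<close> has smaller area.\<close>
  define m where "m = measure lebesgue (cball (0::complex) (1/2))"
  have m: "m > 0" unfolding m_def by (simp add: content_cball_pos)
  obtain U where U: "open U" "A \<subseteq> U" "U - A \<in> lmeasurable" "emeasure lebesgue (U - A) < ennreal m"
    using sets_lebesgue_outer_open[of A m] negA m negligible_imp_sets by blast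
  define K where "K = cball 0 (1/2) - U"
  have K: "compact K" unfolding K_def using U(1) by (simp add: compact_diff)
  have Kpos: "emeasure lebesgue K > 0"
  proof (rule ccontr)
    assume "\<not> ?thesis"
    then have "K \<in> null_sets lebesgue"
      using K by (auto intro!: null_setsI simp: compact_imp_closed)
    then have "negligible (K \<union> A)"
      using negA negligible_Un negligible_iff_null_sets by blast
    then have nKA: "K \<union> A \<in> null_sets lebesgue" by (simp add: negligible_iff_null_sets)
    have "emeasure lebesgue (cball (0::complex) (1/2)) \<le> emeasure lebesgue ((U - A) \<union> (K \<union> A))"
      using U(3) nKA by (intro emeasure_mono) (auto simp: K_def)
    also have "\<dots> = emeasure lebesgue (U - A)"
      using U(3) nKA by (intro emeasure_Un_null_set) auto
    also have "\<dots> < ennreal m" by fact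
    finally show False
      by (simp add: m_def emeasure_eq_measure2)
  qed
  define E where "E = cmod -` (cmod ` K)"
  have "closed E"
    unfolding E_def using K
    by (intro closed_vimage) (auto intro!: compact_imp_closed compact_continuous_image continuous_intros)
  moreover have sub: "E \<subseteq> cball 0 (1/2)"
    by (auto simp: E_def K_def)
  ultimately have cE: "compact E"
    by (metis bounded_cball bounded_subset compact_eq_bounded_closed)
  have irr: "cmod z \<notin> \<rat>" if "z \<in> E" for z
    using that U(2) by (auto simp: E_def K_def A_def)
  have "interior E = {}"
  proof (rule ccontr)
    assume "interior E \<noteq> {}"
    then obtain z where z: "z \<in> interior E" by blast
    then obtain e where e: "e > 0" "ball z e \<subseteq> E" by (meson mem_interior)
    have z0: "z \<noteq> 0" using irr[of z] z interior_subset by fastforce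
    \<comment> \<open>Pushing \<open>z\<close> outward along its ray to the modulus \<open>q\<close>
      moves it by \<open>q - cmod z\<close>, less than \<open>e\<close>. The resulting point would
      lie in \<open>E\<close> although its modulus is rational.\<close>
    obtain q where q: "q \<in> \<rat>" "cmod z < q" "q < cmod z + e"
      using Rats_dense_in_real[of "cmod z" "cmod z + e"] e by auto
    define w where "w = of_real (q / cmod z) * z"
    have q0: "q > 0" using q(2) norm_ge_zero[of z] by linarith
    have "cmod w = q" using z0 q0 by (simp add: w_def norm_mult norm_divide)
    moreover have "dist z w < e"
    proof -
      have "w - z = of_real ((q - cmod z) / cmod z) * z"
        using z0 by (simp add: w_def field_simps)
      then have "cmod (w - z) = q - cmod z"
        using z0 q by (simp add: norm_mult norm_divide del: of_real_diff of_real_divide)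
      then show ?thesis using q by (simp add: dist_norm norm_minus_commute)
    qed
    ultimately show False using e irr[of w] q by auto
  qed
  moreover have "0 \<notin> E" using irr[of 0] by auto
  moreover have "emeasure lebesgue E > 0"
  proof -
    have "K \<subseteq> E" by (auto simp: E_def)
    then have "emeasure lebesgue K \<le> emeasure lebesgue E"
      using cE by (intro emeasure_mono) (auto simp: compact_imp_closed)
    then show ?thesis using Kpos by order
  qed
  moreover have "\<forall>z w. cmod z = cmod w \<longrightarrow> (z \<in> E \<longleftrightarrow> w \<in> E)"
    by (simp add: E_def)
  ultimately show thesis using that cE sub by blast
qed

section \<open>Orthogonality of equivariant functions to holomorphic functions\<close>

text \<open>The disk is rotation invariant, so its indicator may be rotated along with
  \<open>f\<close>. Borel measurability of \<open>f\<close> lets the integrals pass from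
  \<open>lebesgue\<close> to \<open>lborel\<close>, where the change of variables is
  available.\<close>

lemma integral_disk_rotation:
  fixes f :: "complex \<Rightarrow> complex"
  assumes f: "f \<in> borel_measurable borel" and a: "cmod a = 1"
  shows "(\<integral>z. f (a * z) \<partial>disk_measure) = (\<integral>z. f z \<partial>disk_measure)"
proof -
  have [measurable]: "(\<lambda>z. indicator disk z *\<^sub>R f z) \<in> borel_measurable borel"
    using f by (intro borel_measurable_scaleR borel_measurable_indicator) auto
  have meas: "(\<lambda>z. indicator disk (a * z) *\<^sub>R f (a * z)) \<in> borel_measurable borel"
    by (rule measurable_compose[of "(*) a" borel borel]) measurable
  have ind: "indicator disk z = (indicator disk (a * z) :: real)" for z
    using a by (simp add: indicator_def norm_mult)
  have "(\<integral>z. f (a * z) \<partial>disk_measure) = (\<integral>z. indicator disk z *\<^sub>R f (a * z) \<partial>lebesgue)"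
    by (rule integral_restrict_space) auto
  also have "\<dots> = (\<integral>z. indicator disk (a * z) *\<^sub>R f (a * z) \<partial>lebesgue)"
    by (subst ind) (rule refl)
  also have "\<dots> = (\<integral>z. indicator disk (a * z) *\<^sub>R f (a * z) \<partial>lborel)"
    using meas by (intro integral_completion) auto
  also have "\<dots> = (\<integral>z. indicator disk z *\<^sub>R f z \<partial>distr lborel borel ((*) a))"
    by (rule integral_distr[symmetric]) measurable
  also have "\<dots> = (\<integral>z. indicator disk z *\<^sub>R f z \<partial>lborel)"
    by (simp only: distr_lborel_rotation[OF a])
  also have "\<dots> = (\<integral>z. indicator disk z *\<^sub>R f z \<partial>lebesgue)"
    by (intro integral_completion[symmetric]) auto
  also have "\<dots> = (\<integral>z. f z \<partial>disk_measure)"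
    by (rule integral_restrict_space[symmetric]) auto
  finally show ?thesis .
qed

lemma integral_mult_power_eq_0:
  fixes f :: "complex \<Rightarrow> complex"
  assumes f: "f \<in> borel_measurable borel"
    and rot: "\<And>a z. cmod a = 1 \<Longrightarrow> f (a * z) = a * f z"
  shows "(\<integral>z. f z * z ^ n \<partial>disk_measure) = 0"
proof -
  \<comment> \<open>The function \<open>f\<close> contributes one factor \<open>a\<close> and the
    power contributes \<open>n\<close> more, so \<open>a\<close> has to be a root of -1 of order
    \<open>Suc n\<close>.\<close>
  define a where "a = cis (pi / Suc n)"
  have an: "a ^ Suc n = -1"
    unfolding a_def Complex.DeMoivre by (simp del: of_nat_Suc)
  have "(\<integral>z. f z * z ^ n \<partial>disk_measure) = (\<integral>z. f (a * z) * (a * z) ^ n \<partial>disk_measure)"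
    using f by (intro integral_disk_rotation[symmetric]) (auto simp: a_def)
  also have "(\<lambda>z. f (a * z) * (a * z) ^ n) = (\<lambda>z. - (f z * z ^ n))"
  proof
    fix z
    have "f (a * z) * (a * z) ^ n = a ^ Suc n * (f z * z ^ n)"
      by (simp add: rot a_def power_mult_distrib)
    then show "f (a * z) * (a * z) ^ n = - (f z * z ^ n)" by (simp only: an) simp
  qed
  finally show ?thesis by simp
qed

lemma finite_disk_measure: "finite_measure disk_measure"
  by (rule finite_measureI) (use fmeasurableD2[OF lmeasurable_ball] in \<open>simp add: emeasure_restrict_space\<close>)

text \<open>Every Taylor polynomial of \<phi> integrates to 0 against \<open>f\<close>, and
  dominated convergence passes to the limit. The support condition confines the work to radius
  \<open>r < 1\<close>, where the Taylor series converges absolutely and uniformly.\<close>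

lemma integral_mult_holomorphic_eq_0:
  fixes f \<phi> :: "complex \<Rightarrow> complex"
  assumes f: "f \<in> borel_measurable borel"
    and rot: "\<And>a z. cmod a = 1 \<Longrightarrow> f (a * z) = a * f z"
    and bound: "\<And>z. cmod (f z) \<le> B"
    and supp: "\<And>z. cmod z > r \<Longrightarrow> f z = 0" and r: "0 \<le> r" "r < 1"
    and hol: "\<phi> holomorphic_on disk"
  shows "(\<integral>z. f z * \<phi> z \<partial>disk_measure) = 0"
proof -
  interpret finite_measure disk_measure by (rule finite_disk_measure)
  define c where "c n = (deriv ^^ n) \<phi> 0 / fact n" for n
  have sums: "(\<lambda>n. c n * z ^ n) sums \<phi> z" if "cmod z < 1" for z
    using holomorphic_power_series[OF hol, of z] that by (simp add: c_def)
  \<comment> \<open>Convergence of the power series at the larger radius \<open>s\<close> forces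
    absolute convergence at \<open>r\<close>.\<close>
  obtain s where s: "r < s" "s < 1" using r dense by blast
  have summ: "summable (\<lambda>n. cmod (c n) * r ^ n)"
    using powser_insidea[of c "of_real s" "of_real r"] sums[of "of_real s"] s r
    by (auto simp: sums_iff norm_mult norm_power)
  define C where "C = (\<Sum>n. cmod (c n) * r ^ n)"
  have B: "B \<ge> 0" using bound[of 0] norm_ge_zero[of "f 0"] by linarith
  have fd: "f \<in> borel_measurable disk_measure"
    using f by (simp add: borel_measurable_if_D measurable_completion measurable_restrict_space1)
  have pd: "(\<lambda>z. z ^ n) \<in> borel_measurable disk_measure" for n
    by (intro measurable_restrict_space1 measurable_completion) measurable
  have phid: "\<phi> \<in> borel_measurable disk_measure"
    using hol by (intro continuous_imp_measurable_on_sets_lebesgue holomorphic_on_imp_continuous_on) auto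
  have fp: "integrable disk_measure (\<lambda>z. f z * (c n * z ^ n))" for n
  proof (rule integrable_const_bound[where B = "B * cmod (c n)"])
    show "AE z in disk_measure. norm (f z * (c n * z ^ n)) \<le> B * cmod (c n)"
    proof (rule AE_I2)
      fix z assume "z \<in> space disk_measure"
      then have "cmod z \<le> 1" by simp
      then have "cmod (z ^ n) \<le> 1" by (simp add: norm_power power_le_one)
      then have "cmod (c n) * cmod (z ^ n) \<le> cmod (c n)" by (simp add: mult_left_le)
      then show "norm (f z * (c n * z ^ n)) \<le> B * cmod (c n)"
        using bound[of z] B by (simp only: norm_mult) (rule mult_mono, auto)
    qed
    show "(\<lambda>z. f z * (c n * z ^ n)) \<in> borel_measurable disk_measure"
      using fd pd by measurable
  qed
  have "(\<lambda>N. \<integral>z. (\<Sum>n<N. f z * (c n * z ^ n)) \<partial>disk_measure) \<longlonglongrightarrow> (\<integral>z. f z * \<phi> z \<partial>disk_measure)"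
  proof (rule integral_dominated_convergence[where w = "\<lambda>_. B * C"])
    show "AE z in disk_measure. (\<lambda>N. \<Sum>n<N. f z * (c n * z ^ n)) \<longlonglongrightarrow> f z * \<phi> z"
    proof (rule AE_I2)
      fix z assume "z \<in> space disk_measure"
      then show "(\<lambda>N. \<Sum>n<N. f z * (c n * z ^ n)) \<longlonglongrightarrow> f z * \<phi> z"
        using sums_mult[OF sums, of z "f z"] by (simp add: sums_def)
    qed
    show "AE z in disk_measure. norm (\<Sum>n<N. f z * (c n * z ^ n)) \<le> B * C" for N
    proof (rule AE_I2)
      fix z assume "z \<in> space disk_measure"
      show "norm (\<Sum>n<N. f z * (c n * z ^ n)) \<le> B * C"
      \<comment> \<open>Beyond radius \<open>r\<close> the factor \<open>f z\<close> kills every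
        partial sum; within it \<open>C\<close> bounds the Taylor polynomials, independently of
        \<open>N\<close>.\<close>
      proof (cases "cmod z > r")
        case True
        have "C \<ge> 0" unfolding C_def using summ r by (intro suminf_nonneg) auto
        then show ?thesis using True supp[of z] B by simp
      next
        case False
        have "norm (\<Sum>n<N. c n * z ^ n) \<le> (\<Sum>n<N. cmod (c n) * r ^ n)"
          using False by (intro sum_norm_le) (simp add: norm_mult norm_power mult_left_mono power_mono)
        also have "\<dots> \<le> C"
          unfolding C_def using summ r by (intro sum_le_suminf) auto
        finally show ?thesis
          using bound[of z] B by (simp only: sum_distrib_left[symmetric] norm_mult) (rule mult_mono, auto)
      qed
    qed
    show "(\<lambda>z. f z * \<phi> z) \<in> borel_measurable disk_measure" using fd phid by measurable
    show "(\<lambda>z. \<Sum>n<N. f z * (c n * z ^ n)) \<in> borel_measurable disk_measure" for N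
      using fp by (intro borel_measurable_sum) auto
  qed auto
  moreover have "(\<integral>z. (\<Sum>n<N. f z * (c n * z ^ n)) \<partial>disk_measure) = 0" for N
  proof -
    have "(\<integral>z. f z * (c n * z ^ n) \<partial>disk_measure) = 0" for n
      using integral_mult_power_eq_0[OF f rot, of n]
      by (simp add: mult.left_commute[of _ "c n"])
    then show ?thesis using fp by simp
  qed
  ultimately show ?thesis by (simp add: LIMSEQ_const_iff)
qed


section \<open>The parameter circle, and decreasability in the class of zero\<close>

lemma infinite_sphere_complex: "infinite (sphere (0::complex) 1)"
proof
  assume "finite (sphere (0::complex) 1)"
  then obtain x where "sphere (0::complex) 1 = {x}"
    using connected_finite_iff_sing[OF connected_sphere[of "0::complex" 1]] by force
  moreover have "1 \<in> sphere (0::complex) 1" "-1 \<in> sphere (0::complex) 1" by simp_all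
  ultimately show False by (metis one_neq_neg_one singletonD)
qed

lemma zero_in_Bel: "(\<lambda>_. 0) \<in> Bel"
proof -
  have "esssup disk_measure (\<lambda>z. ereal (cmod 0)) \<le> 0"
    by (intro esssup_I) auto
  then show ?thesis
    by (auto simp: Bel_def Linf_norm_def intro: le_less_trans)
qed

lemma zero_in_Z_class: "\<nu> \<in> Z_class (\<lambda>_. 0) \<Longrightarrow> (\<lambda>_. 0) \<in> Z_class \<nu>"
  by (auto simp: Z_class_def zero_in_Bel)

text \<open>A decrease by \<delta> on a domain \<open>G\<close> forces the modulus of \<nu> to be at
  least \<delta> a.e. on \<open>G\<close>. But \<open>G\<close> does not fit into the support, so it
  meets the open set \<open>V\<close> on which \<nu> vanishes a.e. Decreasability itself is
  witnessed by 0.\<close>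

lemma pseudo_non_decreasable_if_interior_support_empty:
  assumes \<nu>: "\<nu> \<in> Z_class (\<lambda>_. 0)" and int: "interior (support_set \<nu>) = {}"
    and nz: "\<not> (AE z in disk_measure. \<nu> z = 0)"
  shows "pseudo_non_decreasable \<nu>"
  unfolding pseudo_non_decreasable_def weakly_non_decreasable_def
proof
  show "\<not> strongly_decreasable \<nu>"
  proof
    assume "strongly_decreasable \<nu>"
    then obtain \<mu> G \<delta> where G: "open G" "G \<noteq> {}" "G \<subseteq> disk" "\<delta> > 0"
      and le: "AE z in disk_measure. z \<in> G \<longrightarrow> cmod (\<mu> z) \<le> cmod (\<nu> z) - \<delta>"
      unfolding strongly_decreasable_def by blast
    define V where "V = \<Union> (null_open_sets \<nu>)"
    have V: "open V" "AE z in disk_measure. z \<in> V \<longrightarrow> \<nu> z = 0"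
      using Union_null_open_sets[of \<nu>] by (auto simp: V_def null_open_sets_def)
    have "\<not> G \<subseteq> support_set \<nu>"
      using G(1,2) int interior_maximal by blast
    then have ne: "G \<inter> V \<noteq> {}"
      using G(3) by (auto simp: support_set_def V_def)
    have "AE z in disk_measure. z \<notin> G \<inter> V"
      using le V(2)
    proof eventually_elim
      case (elim z)
      then show ?case using G(4) order_trans[OF norm_ge_zero, of "\<mu> z" "- \<delta>"] by auto
    qed
    then have "AE z in lebesgue. z \<in> - (G \<inter> V)"
      using G(3) by (subst (asm) AE_restrict_space_iff) (auto elim!: eventually_mono)
    \<comment> \<open>A closed set that contains almost every point is the whole plane, so the open
      set \<open>G \<inter> V\<close> would be empty.\<close>
    then show False
      using mem_closed_if_AE_lebesgue[of "- (G \<inter> V)"] ne G(1) V(1) by blast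
  qed
  show "\<not> non_decreasable \<nu>"
  proof
    assume "non_decreasable \<nu>"
    then have "AE z in disk_measure. 0 = \<nu> z"
      using zero_in_Z_class[OF \<nu>] unfolding non_decreasable_def by auto
    then have "AE z in disk_measure. \<nu> z = 0" by eventually_elim simp
    then show False using nz by contradiction
  qed
qed

section \<open>The infinite family and the uniqueness of zero\<close>

theorem theorem1:
  shows "(\<forall>c::real. c > 0 \<longrightarrow>
            infinite ({\<nu> \<in> Z_class (\<lambda>_. 0). pseudo_non_decreasable \<nu> \<and>
                         Linf_norm \<nu> = ereal c \<and> interior (support_set \<nu>) = {}} // ae_eq))
       \<and> (\<lambda>_. 0) \<in> Z_class (\<lambda>_. 0) \<and> non_decreasable (\<lambda>_. 0)
       \<and> (\<forall>\<mu>\<in>Z_class (\<lambda>_. 0). non_decreasable \<mu> \<longrightarrow> (AE z in disk_measure. \<mu> z = 0))"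
proof (intro conjI allI impI ballI)
  show "(\<lambda>_. 0) \<in> Z_class (\<lambda>_. 0)"
    by (simp add: Z_class_def zero_in_Bel)
  show "non_decreasable (\<lambda>_. 0)"
    by (simp add: non_decreasable_def)
next
  fix \<mu> assume "\<mu> \<in> Z_class (\<lambda>_. 0)" "non_decreasable \<mu>"
  \<comment> \<open>Zero lies in the class of \<mu> and is dominated by everything, so it is a
    competitor that a non-decreasable \<mu> must equal.\<close>
  then have "AE z in disk_measure. 0 = \<mu> z"
    using zero_in_Z_class[of \<mu>] unfolding non_decreasable_def by auto
  then show "AE z in disk_measure. \<mu> z = 0" by eventually_elim simp
next
  fix c :: real assume c: "c > 0"
  obtain E :: "complex set" where E: "compact E" "E \<subseteq> cball 0 (1/2)" "interior E = {}" "0 \<notin> E"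
    "\<forall>z w. cmod z = cmod w \<longrightarrow> (z \<in> E \<longleftrightarrow> w \<in> E)" "emeasure lebesgue E > 0"
    using fat_rotation_invariant_set .
  let ?S = "{\<nu> \<in> Z_class (\<lambda>_. 0). pseudo_non_decreasable \<nu> \<and>
                Linf_norm \<nu> = ereal c \<and> interior (support_set \<nu>) = {}}"
  \<comment> \<open>The parameter \<open>w\<close> will run over the unit circle and index the
    family. As 0 is not in \<open>E\<close>, \<open>sgn z\<close> is unimodular there, so the
    modulus is \<open>c\<close> on all of \<open>E\<close>.\<close>
  define \<nu> where "\<nu> w z = (if z \<in> E then w * of_real c * sgn z else 0)" for w z :: complex
  have E_disk: "E \<subseteq> disk" using E(2) by auto
  \<comment> \<open>The positive measure of \<open>E\<close> enters here. This fact yields the lower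
    bound for the norm, the failure of \<nu> to vanish a.e., and the distinctness of the classes for
    different \<open>w\<close>.\<close>
  have not_AE: "\<not> (AE z in disk_measure. P z)" if "\<And>z. z \<in> E \<Longrightarrow> \<not> P z" for P
  proof
    assume "AE z in disk_measure. P z"
    then have "AE z in lebesgue. z \<in> disk \<longrightarrow> P z"
      by (simp add: AE_restrict_space_iff)
    then have "AE z in lebesgue. z \<notin> E"
      by eventually_elim (use that E_disk in blast)
    moreover have "E \<in> sets lebesgue"
      using E(1) by (simp add: compact_imp_closed)
    ultimately have "E \<in> null_sets lebesgue"
      by (simp add: AE_iff_null_sets)
    then show False using E(6) by auto
  qed
  have norm_\<nu>: "cmod (\<nu> w z) = (if z \<in> E then c else 0)" if "cmod w = 1" for w z
    using that c E(4) by (auto simp: \<nu>_def norm_mult norm_sgn)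
  have meas: "\<nu> w \<in> borel_measurable borel" for w
  proof -
    have "E \<in> sets borel" using E(1) by (simp add: borel_compact)
    then show ?thesis
      unfolding \<nu>_def sgn_div_norm by measurable
  qed
  have meas_disk: "\<nu> w \<in> borel_measurable disk_measure" for w
    using meas by (simp add: measurable_completion measurable_restrict_space1)
  have norm: "Linf_norm (\<nu> w) = ereal c" if w: "cmod w = 1" for w
    unfolding Linf_norm_def
  proof (rule antisym)
    have m: "(\<lambda>z. ereal (cmod (\<nu> w z))) \<in> borel_measurable disk_measure"
      using meas_disk by measurable
    show "esssup disk_measure (\<lambda>z. ereal (cmod (\<nu> w z))) \<le> ereal c"
      using m c by (intro esssup_I) (auto simp: norm_\<nu>[OF w])
    show "ereal c \<le> esssup disk_measure (\<lambda>z. ereal (cmod (\<nu> w z)))"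
    proof (rule ccontr)
      assume "\<not> ?thesis"
      moreover have "AE z in disk_measure.
          ereal (cmod (\<nu> w z)) \<le> esssup disk_measure (\<lambda>z. ereal (cmod (\<nu> w z)))"
        by (rule esssup_AE)
      ultimately have "AE z in disk_measure. ereal (cmod (\<nu> w z)) < ereal c"
        by (elim eventually_mono) (metis le_less_trans not_le)
      then show False by (rule notE[OF not_AE, rotated]) (simp add: norm_\<nu>[OF w])
    qed
  qed
  have Bel: "\<nu> w \<in> Bel" if "cmod w = 1" for w
    using meas_disk norm[OF that] by (simp add: Bel_def)
  have Z: "\<nu> w \<in> Z_class (\<lambda>_. 0)" if w: "cmod w = 1" for w
  proof -
    \<comment> \<open>Equivariance combines the rotation invariance of \<open>E\<close> with the
      multiplicativity of \<open>sgn\<close>.\<close>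
    have rot: "\<nu> w (a * z) = a * \<nu> w z" if "cmod a = 1" for a z
    proof -
      have "a * z \<in> E \<longleftrightarrow> z \<in> E" using that by (intro E(5)[rule_format]) (simp add: norm_mult)
      moreover have "sgn a = a" using that by (simp add: sgn_eq)
      ultimately show ?thesis by (simp add: \<nu>_def sgn_mult)
    qed
    have "(\<integral>z. \<nu> w z * \<phi> z \<partial>disk_measure) = 0" if "\<phi> \<in> Q" for \<phi>
    proof (rule integral_mult_holomorphic_eq_0[where r = "1/2" and B = c])
      show "\<nu> w z = 0" if "1/2 < cmod z" for z
        using that E(2) by (auto simp: \<nu>_def)
      show "cmod (\<nu> w z) \<le> c" for z
        using c by (simp add: norm_\<nu>[OF w])
      show "\<phi> holomorphic_on disk" using that by (simp add: Q_def)
    qed (use meas rot in auto)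
    then show ?thesis using Bel[OF w] by (simp add: Z_class_def)
  qed
  have "support_set (\<nu> w) \<subseteq> E" for w
  proof -
    \<comment> \<open>As \<open>E\<close> is closed, its complement in the disk is open and is
      removed from the support.\<close>
    have "disk - E \<in> null_open_sets (\<nu> w)"
      using E(1) by (auto simp: null_open_sets_def \<nu>_def compact_imp_closed open_Diff)
    then show ?thesis by (auto simp: support_set_def)
  qed
  then have supp: "interior (support_set (\<nu> w)) = {}" for w
    using E(3) interior_mono by blast
  have S: "\<nu> w \<in> ?S" if w: "cmod w = 1" for w
  proof -
    have "\<not> (AE z in disk_measure. \<nu> w z = 0)"
      using c norm_\<nu>[OF w] by (intro not_AE) (metis norm_zero less_irrefl)
    then show ?thesis
      using Z norm supp pseudo_non_decreasable_if_interior_support_empty w by auto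
  qed
  \<comment> \<open>The quotient is infinite because the infinite unit circle embeds in it:
    different parameters give functions that differ at every point of \<open>E\<close>.\<close>
  have inj: "inj_on (\<lambda>w. ae_eq `` {\<nu> w}) (sphere 0 1)"
  proof (rule inj_onI)
    fix v w :: complex assume "v \<in> sphere 0 1" "w \<in> sphere 0 1" "ae_eq `` {\<nu> v} = ae_eq `` {\<nu> w}"
    then have "(\<nu> v, \<nu> w) \<in> ae_eq"
      using Bel eq_equiv_class[OF _ equiv_ae_eq] by simp
    then have "AE z in disk_measure. \<nu> v z = \<nu> w z"
      by (simp add: ae_eq_def)
    moreover have "\<nu> v z \<noteq> \<nu> w z" if "z \<in> E" "v \<noteq> w" for z
      using that c E(4) by (auto simp: \<nu>_def sgn_zero_iff)
    ultimately show "v = w"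
      using not_AE[of "\<lambda>z. \<nu> v z = \<nu> w z"] by blast
  qed
  have "(\<lambda>w. ae_eq `` {\<nu> w}) ` sphere 0 1 \<subseteq> ?S // ae_eq"
    using S by (intro image_subsetI quotientI) simp
  moreover have "infinite ((\<lambda>w. ae_eq `` {\<nu> w}) ` sphere 0 1)"
    using infinite_sphere_complex finite_image_iff[OF inj] by simp
  ultimately show "infinite (?S // ae_eq)"
    by (rule infinite_super)
qed

end
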